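(* Let $K \subset \mathbb{R}^d$ be a smoothly bounded convex body endowed with the uniform distribution, and let $k \ge 0$ be a fixed integer. There is a constant $c_k > 0$, depending only on the volume $\mu(K)$ and $k$, such that if $r = r_n \ge c_k (\log n/n)^{1/d}$, then the random Vietoris-Rips complex $R(X_n;r)$ is a.a.s. $k$-connected.
   Context: Here a smoothly bounded convex body means a compact, convex set with nonempty interior; $\mu$ is Lebesgue measure. $X_n = \{x_1,\ldots,x_n\}$ where $x_1, x_2, \ldots$ are i.i.d. uniform points in $K$. For $r>0$, $R(X_n;r)$ is the simplicial complex with vertex set $X_n$ in which $\sigma \subseteq X_n$ is a face iff all pairwise Euclidean distances between points of $\sigma$ are at most $r$. A topological space $T$ is $k$-connected if every map $S^i \to T$ from an $i$-dimensional sphere is homotopically trivial for $0 \le i \le k$. A property holds asymptotically almost surely (a.a.s.) if its probability tends to $1$ as $n \to \infty$. *)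

theory Defs
  imports "HOL-Probability.Probability"
begin

text \<open>A convex body is a compact convex set with nonempty interior.  Its boundary is smooth if
  every boundary point has exactly one supporting hyperplane, i.e. exactly one outer unit normal
  vector.  For convex bodies this is the same as the boundary being a \<open>C\<^sup>1\<close> hypersurface, so it is
  implied by every stronger notion of smoothness, such as \<open>C\<^sup>\<infinity>\<close>.\<close>

definition convex_body :: "'a::euclidean_space set \<Rightarrow> bool"
  where "convex_body K \<longleftrightarrow> compact K \<and> convex K \<and> interior K \<noteq> {}"

definition smoothly_bounded :: "'a::euclidean_space set \<Rightarrow> bool"
  where "smoothly_bounded K \<longleftrightarrow>
    (\<forall>x\<in>frontier K. \<exists>!u. norm u = 1 \<and> (\<forall>y\<in>K. u \<bullet> y \<le> u \<bullet> x))"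

text \<open>The law of a sequence of independent points, each uniformly distributed in \<open>K\<close>.  The sample
  points are the coordinates of the product space.\<close>

definition iid_uniform :: "'a::euclidean_space set \<Rightarrow> (nat \<Rightarrow> 'a) measure"
  where "iid_uniform K = Pi\<^sub>M UNIV (\<lambda>_. uniform_measure lborel K)"

definition vietoris_rips :: "'a::metric_space set \<Rightarrow> real \<Rightarrow> 'a set set"
  where "vietoris_rips X r = {\<sigma>. \<sigma> \<subseteq> X \<and> (\<forall>x\<in>\<sigma>. \<forall>y\<in>\<sigma>. dist x y \<le> r)}"

text \<open>Points of the realization are given by their barycentric coordinates: the support is a face.
  The empty face contributes no point, because the coordinates sum to 1.  The topology is that of
  pointwise convergence of the coordinates, which is the usual one for complexes with finitely many
  vertices (for complexes that are not locally finite it is coarser than the weak topology).\<close>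

definition geometric_realization :: "'a set set \<Rightarrow> ('a \<Rightarrow> real) topology"
  where "geometric_realization \<Delta> = subtopology (powertop_real UNIV)
    {t. (\<forall>v. 0 \<le> t v) \<and> {v. t v \<noteq> 0} \<in> \<Delta> \<and> (\<Sum>v\<in>{v. t v \<noteq> 0}. t v) = 1}"

definition k_connected :: "nat \<Rightarrow> 'a topology \<Rightarrow> bool"
  where "k_connected k T \<longleftrightarrow>
    (\<forall>i\<le>k. \<forall>f. continuous_map (nsphere i) T f \<longrightarrow>
      (\<exists>c. homotopic_with (\<lambda>_. True) (nsphere i) T f (\<lambda>_. c)))"

end

theory Submission
  imports Defs
begin

text \<open>At the scale \<open>(ln n / n) powr (1 / d)\<close> the sample becomes dense in \<open>K\<close>: with probability
  tending to 1, every point of \<open>K\<close> is within a small fixed fraction of \<open>r\<close> of a sample point.  The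
  proof shows that the Rips complex is then contractible, hence \<open>k\<close>-connected for all \<open>k\<close> at once.

  The deterministic part is \<open>contractible_vietoris_rips_of_dense\<close>: if \<open>X\<close> is finite and
  \<open>\<rho>\<close>-dense in a convex set \<open>K\<close> containing it, with \<open>128 * \<rho> \<le> r\<close>, then \<open>R(X;r)\<close> is
  contractible.  A partition of unity on \<open>K\<close> gives a map \<open>g\<close> from \<open>K\<close> to the complex, and
  barycentric evaluation gives a map \<open>\<pi>\<close> back to \<open>K\<close>.  As \<open>K\<close> is contractible, it would suffice
  that \<open>g \<circ> \<pi>\<close> is homotopic to the identity.  The straight line between the two only works on
  faces of diameter at most \<open>r - 2 * \<rho>\<close>, so the complex is first deformed into its subcomplex of
  that smaller scale.  This is done on the barycentric subdivision: a face with two vertices at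
  distance at least \<open>r / 2\<close> is moved to a sample point near their midpoint, which by the
  parallelogram law is within \<open>31 / 32 * r\<close> of all points of the larger faces
  (\<open>face_center_exists\<close>).

  Density is a coupon-collector argument (\<open>prob_k_connected_ge\<close>).  By smoothness, at small scales
  each ball around a point of \<open>K\<close> contains a ball of a quarter of its radius inside \<open>K\<close>
  (\<open>smooth_body_uniform_balls\<close>); the hitting probability therefore depends on \<open>K\<close> only through
  its volume, which is why the constant does too.

  Since the measure of a non-measurable set carries no information, it must also be shown that the
  event is measurable (\<open>sets_k_connected_event\<close>).\<close>

section \<open>Maps into geometric realizations\<close>

abbreviation supp :: "('a \<Rightarrow> real) \<Rightarrow> 'a set" where "supp t \<equiv> {v. t v \<noteq> 0}"

lemma topspace_geometric_realization:
  "topspace (geometric_realization \<Delta>) = {t. (\<forall>v. 0 \<le> t v) \<and> supp t \<in> \<Delta> \<and> (\<Sum>v\<in>supp t. t v) = 1}"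
  by (simp add: geometric_realization_def)

lemma continuous_map_coordinate:
  "continuous_map (geometric_realization \<Delta>) euclideanreal (\<lambda>t. t v)"
  unfolding geometric_realization_def
  by (intro continuous_map_from_subtopology continuous_map_product_projection) simp

lemma continuous_map_into_geometric_realization:
  "continuous_map T (geometric_realization \<Delta>) f \<longleftrightarrow>
    (\<forall>v. continuous_map T euclideanreal (\<lambda>p. f p v)) \<and>
    f \<in> topspace T \<rightarrow> topspace (geometric_realization \<Delta>)"
  unfolding geometric_realization_def
  by (simp add: continuous_map_in_subtopology continuous_map_componentwise_UNIV)

definition normalized :: "'a set \<Rightarrow> ('a \<Rightarrow> real) \<Rightarrow> 'a \<Rightarrow> real" where
  "normalized X w = (\<lambda>v. if v \<in> X then w v / (\<Sum>x\<in>X. w x) else 0)"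

lemma supp_normalized:
  assumes "finite X" "\<And>v. v \<in> X \<Longrightarrow> 0 \<le> w v" "\<exists>v\<in>X. 0 < w v"
  shows "supp (normalized X w) = {v \<in> X. 0 < w v}"
proof -
  have "0 < (\<Sum>x\<in>X. w x)"
    using assms by (meson sum_pos2)
  then show ?thesis
    using assms(2) by (force simp: normalized_def)
qed

lemma continuous_map_normalized:
  assumes X: "finite X"
    and w: "\<And>v. v \<in> X \<Longrightarrow> continuous_map T euclideanreal (\<lambda>p. w p v)"
    and nonneg: "\<And>p v. p \<in> topspace T \<Longrightarrow> v \<in> X \<Longrightarrow> 0 \<le> w p v"
    and pos: "\<And>p. p \<in> topspace T \<Longrightarrow> \<exists>v\<in>X. 0 < w p v"
    and face: "\<And>p. p \<in> topspace T \<Longrightarrow> {v \<in> X. 0 < w p v} \<in> \<Delta>"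
  shows "continuous_map T (geometric_realization \<Delta>) (\<lambda>p. normalized X (w p))"
proof -
  have total: "0 < (\<Sum>x\<in>X. w p x)" if "p \<in> topspace T" for p
    using pos[OF that] nonneg[OF that] X by (meson sum_pos2)
  have "continuous_map T euclideanreal (\<lambda>p. normalized X (w p) v)" for v
  proof (cases "v \<in> X")
    case True
    have "continuous_map T euclideanreal (\<lambda>p. w p v / (\<Sum>x\<in>X. w p x))"
    proof (rule continuous_map_real_divide)
      show "continuous_map T euclideanreal (\<lambda>p. \<Sum>x\<in>X. w p x)"
        using X w by (rule continuous_map_sum)
      show "(\<Sum>x\<in>X. w p x) \<noteq> 0" if "p \<in> topspace T" for p
        using total[OF that] by simp
    qed (rule w[OF True])
    then show ?thesis using True by (simp add: normalized_def)
  qed (simp add: normalized_def)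
  moreover have "normalized X (w p) \<in> topspace (geometric_realization \<Delta>)" if p: "p \<in> topspace T" for p
  proof -
    have s: "supp (normalized X (w p)) = {v \<in> X. 0 < w p v}"
      using X nonneg[OF p] pos[OF p] by (rule supp_normalized)
    have "(\<Sum>v\<in>supp (normalized X (w p)). normalized X (w p) v) = (\<Sum>v\<in>X. normalized X (w p) v)"
      by (rule sum.mono_neutral_left) (use X s in auto)
    also have "\<dots> = (\<Sum>v\<in>X. w p v) / (\<Sum>x\<in>X. w p x)"
      unfolding sum_divide_distrib by (rule sum.cong) (simp_all add: normalized_def)
    also have "\<dots> = 1"
      using total[OF p] by (intro divide_self) simp
    finally have "(\<Sum>v\<in>supp (normalized X (w p)). normalized X (w p) v) = 1" .
    moreover have "0 \<le> normalized X (w p) v" for v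
      using nonneg[OF p] total[OF p] by (auto simp: normalized_def)
    ultimately show ?thesis
      using s face[OF p] by (simp add: topspace_geometric_realization)
  qed
  ultimately show ?thesis
    by (simp add: continuous_map_into_geometric_realization)
qed

lemma homotopic_straight_line:
  assumes f: "continuous_map T (geometric_realization \<Delta>) f"
    and g: "continuous_map T (geometric_realization \<Delta>) g"
    and finite: "\<And>\<sigma>. \<sigma> \<in> \<Delta> \<Longrightarrow> finite \<sigma>"
    and face: "\<And>p. p \<in> topspace T \<Longrightarrow> supp (f p) \<union> supp (g p) \<in> \<Delta>"
  shows "homotopic_with (\<lambda>_. True) T (geometric_realization \<Delta>) f g"
proof -
  define h where "h = (\<lambda>(s::real, p) v. (1 - s) * f p v + s * g p v)"
  have fg: "f p \<in> topspace (geometric_realization \<Delta>)" "g p \<in> topspace (geometric_realization \<Delta>)"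
    if "p \<in> topspace T" for p
    using f g that by (auto simp: continuous_map_into_geometric_realization)
  have "h (s, p) \<in> topspace (geometric_realization \<Delta>)" if p: "p \<in> topspace T" and s: "s \<in> {0..1}" for s p
  proof -
    have f0: "0 \<le> f p v" and g0: "0 \<le> g p v" for v
      using fg[OF p] by (auto simp: topspace_geometric_realization)
    have sums: "(\<Sum>v\<in>supp (f p). f p v) = 1" "(\<Sum>v\<in>supp (g p). g p v) = 1"
      using fg[OF p] by (auto simp: topspace_geometric_realization)
    let ?U = "supp (f p) \<union> supp (g p)"
    have U: "finite ?U"
      using finite face[OF p] by blast
    have "(\<Sum>v\<in>?U. f p v) = 1" "(\<Sum>v\<in>?U. g p v) = 1"
      using sums U by (auto intro: sum.mono_neutral_right[THEN trans])
    then have "(\<Sum>v\<in>?U. h (s, p) v) = 1"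
      by (simp add: h_def sum.distrib flip: sum_distrib_left)
    moreover have "(\<Sum>v\<in>supp (h (s, p)). h (s, p) v) = (\<Sum>v\<in>?U. h (s, p) v)"
      using U by (intro sum.mono_neutral_left) (auto simp: h_def)
    moreover have "0 \<le> h (s, p) v" for v
      using f0 g0 s by (simp add: h_def)
    moreover have "supp (h (s, p)) \<in> \<Delta>"
    proof -
      \<comment> \<open>At the end points the support shrinks to that of \<open>f p\<close> or \<open>g p\<close>.\<close>
      consider "s = 0" | "s = 1" | "0 < s" "s < 1" using s by force
      then show ?thesis
      proof cases
        case 3
        have "h (s, p) v = 0 \<longleftrightarrow> f p v = 0 \<and> g p v = 0" for v
          using 3 f0[of v] g0[of v]
          by (auto simp: h_def add_nonneg_eq_0_iff)
        then have "supp (h (s, p)) = ?U" by blast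
        then show ?thesis using face[OF p] by simp
      qed (use fg[OF p] in \<open>auto simp: h_def topspace_geometric_realization\<close>)
    qed
    ultimately show ?thesis
      by (simp add: topspace_geometric_realization)
  qed
  moreover have "continuous_map (prod_topology (top_of_set {0..1}) T) euclideanreal (\<lambda>x. h x v)" for v
  proof -
    have 1: "continuous_map (prod_topology (top_of_set {0..1}) T) euclideanreal (\<lambda>x. fst x :: real)"
      using continuous_map_fst continuous_map_into_fulltopology by blast
    have 2: "continuous_map (prod_topology (top_of_set {0..1::real}) T) euclideanreal (\<lambda>x. k (snd x) v)"
      if "continuous_map T (geometric_realization \<Delta>) k" for k
      using that continuous_map_compose[OF continuous_map_snd, of T euclideanreal "\<lambda>p. k p v"]
      by (simp add: continuous_map_into_geometric_realization o_def)
    show ?thesis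
      unfolding h_def case_prod_unfold
      using 1 2[OF f] 2[OF g] by (intro continuous_intros) auto
  qed
  ultimately have "continuous_map (prod_topology (top_of_set {0..1}) T) (geometric_realization \<Delta>) h"
    by (auto simp: continuous_map_into_geometric_realization)
  moreover have "h (0, p) = f p" "h (1, p) = g p" for p
    by (auto simp: h_def)
  ultimately show ?thesis
    unfolding homotopic_with_def by blast
qed

text \<open>The parallelogram law gives the factor \<open>sqrt (15 / 16)\<close>, which is rounded up to the rational
  \<open>31 / 32\<close>.\<close>

lemma dist_midpoint_le:
  fixes a b z :: "'a::real_inner"
  assumes "dist z a \<le> r" "dist z b \<le> r" "r / 2 \<le> dist a b" "0 \<le> r"
  shows "dist z (midpoint a b) \<le> 31 / 32 * r"
proof -
  define u w where "u = z - a" and "w = z - b"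
  have "z - midpoint a b = (1/2) *\<^sub>R ((z + z) - (a + b))"
    by (simp only: scaleR_right_diff_distrib scaleR_half_double midpoint_def) simp
  also have "(z + z) - (a + b) = u + w"
    by (simp add: u_def w_def)
  finally have m: "dist z (midpoint a b) = norm (u + w) / 2"
    by (simp add: dist_norm)
  have ab: "dist a b = norm (u - w)"
    by (subst dist_commute) (simp add: dist_norm u_def w_def)
  have "(norm (u + w))\<^sup>2 + (norm (u - w))\<^sup>2 = 2 * (norm u)\<^sup>2 + 2 * (norm w)\<^sup>2"
    unfolding power2_norm_eq_inner inner_add_left inner_add_right inner_diff_left inner_diff_right
    by simp
  moreover have "(norm u)\<^sup>2 \<le> r\<^sup>2" "(norm w)\<^sup>2 \<le> r\<^sup>2"
    using assms(1,2) by (auto simp: u_def w_def dist_norm intro: power_mono)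
  moreover have "(r/2)\<^sup>2 \<le> (norm (u - w))\<^sup>2"
    using assms(3,4) unfolding ab by (intro power_mono) auto
  ultimately have "(dist z (midpoint a b))\<^sup>2 \<le> 15 / 16 * r\<^sup>2"
    unfolding m by (simp add: power_divide)
  also have "\<dots> \<le> (31 / 32 * r)\<^sup>2"
    by (simp add: power_mult_distrib power_divide)
  finally show ?thesis
    by (rule power2_le_imp_le) (use assms(4) in simp)
qed

section \<open>Barycentric weights of the level sets\<close>

text \<open>In the barycentric subdivision, the carrier of a point \<open>t\<close> is the chain of the superlevel sets
  \<open>{v. t v \<ge> s}\<close> with \<open>s > 0\<close>.  Up to normalization, any continuous function that is positive
  exactly when \<open>\<sigma>\<close> is one of these sets can serve as the coordinate of \<open>t\<close> at the barycentre of
  \<open>\<sigma>\<close>; a product is chosen because its continuity is immediate.\<close>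

definition flag_weight :: "'a set \<Rightarrow> 'a set \<Rightarrow> ('a \<Rightarrow> real) \<Rightarrow> real" where
  "flag_weight X \<sigma> t = (\<Prod>a\<in>\<sigma>. max 0 (t a) * (\<Prod>b\<in>X - \<sigma>. max 0 (t a - t b)))"

lemma flag_weight_nonneg: "0 \<le> flag_weight X \<sigma> t"
  by (auto simp: flag_weight_def intro!: prod_nonneg mult_nonneg_nonneg)

lemma flag_weight_pos_iff:
  assumes "finite X" "\<sigma> \<subseteq> X"
  shows "0 < flag_weight X \<sigma> t \<longleftrightarrow> (\<forall>a\<in>\<sigma>. 0 < t a \<and> (\<forall>b\<in>X - \<sigma>. t b < t a))"
proof -
  have "finite \<sigma>"
    using assms finite_subset by blast
  have "0 < flag_weight X \<sigma> t \<longleftrightarrow> flag_weight X \<sigma> t \<noteq> 0"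
    using flag_weight_nonneg[of X \<sigma> t] by auto
  also have "\<dots> \<longleftrightarrow> (\<forall>a\<in>\<sigma>. max 0 (t a) \<noteq> 0 \<and> (\<forall>b\<in>X - \<sigma>. max 0 (t a - t b) \<noteq> 0))"
    using assms(1) \<open>finite \<sigma>\<close> by (auto simp: flag_weight_def)
  also have "\<dots> \<longleftrightarrow> (\<forall>a\<in>\<sigma>. 0 < t a \<and> (\<forall>b\<in>X - \<sigma>. t b < t a))"
  proof -
    have "max 0 x \<noteq> 0 \<longleftrightarrow> 0 < x" for x :: real by auto
    then show ?thesis by simp
  qed
  finally show ?thesis .
qed

lemma flag_weight_chain:
  assumes "finite X" "\<sigma> \<subseteq> X" "\<tau> \<subseteq> X" "0 < flag_weight X \<sigma> t" "0 < flag_weight X \<tau> t"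
  shows "\<sigma> \<subseteq> \<tau> \<or> \<tau> \<subseteq> \<sigma>"
proof (rule ccontr)
  assume "\<not> ?thesis"
  then obtain a b where "a \<in> \<sigma> - \<tau>" "b \<in> \<tau> - \<sigma>" by blast
  then have "t b < t a" "t a < t b"
    using assms by (auto simp: flag_weight_pos_iff)
  then show False by simp
qed

text \<open>The vertices of maximal coordinate form a superlevel set.\<close>

lemma flag_weight_pos_exists:
  assumes "finite X" "\<exists>v\<in>X. 0 < t v"
  shows "\<exists>\<sigma>\<subseteq>X. \<sigma> \<noteq> {} \<and> 0 < flag_weight X \<sigma> t"
proof -
  define m where "m = Max (t ` X)"
  define \<sigma> where "\<sigma> = {v \<in> X. t v = m}"
  have m: "t v \<le> m" if "v \<in> X" for v
    using that assms(1) by (simp add: m_def)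
  have "m \<in> t ` X"
    unfolding m_def using assms by (intro Max_in) auto
  then have "\<sigma> \<noteq> {}" by (auto simp: \<sigma>_def)
  moreover have "0 < m"
    using assms(2) m by force
  then have "0 < flag_weight X \<sigma> t"
    using assms(1) m by (subst flag_weight_pos_iff) (force simp: \<sigma>_def less_le)+
  moreover have "\<sigma> \<subseteq> X" by (simp add: \<sigma>_def)
  ultimately show ?thesis by blast
qed

section \<open>Contractibility of the Rips complex of a dense set\<close>

lemma finite_vietoris_rips: "finite X \<Longrightarrow> \<sigma> \<in> vietoris_rips X r \<Longrightarrow> finite \<sigma>"
  by (auto simp: vietoris_rips_def intro: finite_subset)

lemma vietoris_rips_subset: "\<sigma> \<in> vietoris_rips X r \<Longrightarrow> \<tau> \<subseteq> \<sigma> \<Longrightarrow> \<tau> \<in> vietoris_rips X r"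
  by (auto simp: vietoris_rips_def)

text \<open>The vertex map \<open>c\<close> of the subdivision.  Its two distance properties serve two homotopies: a
  face together with the centres along a chain of its subfaces spans a face of scale \<open>r\<close>, and these
  centres alone span a face of scale \<open>r - 2 * \<rho>\<close>.

  A small face (diameter below \<open>r / 2\<close>) is sent to one of its vertices; for such faces the midpoint
  rule would gain nothing, and approximating the midpoint could push the centre farther than \<open>r\<close> from
  the vertices of a larger face.  A large face contains \<open>a\<close>, \<open>b\<close> at distance at least \<open>r / 2\<close> and
  is sent to a point of \<open>X\<close> near their midpoint, which is within \<open>31 / 32 * r\<close> of every point in
  the convex hull of a face containing them.  The gain \<open>r / 32 \<ge> 4 * \<rho>\<close> pays for two
  approximation errors \<open>\<rho>\<close> and the margin \<open>2 * \<rho>\<close>.\<close>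

lemma face_center_exists:
  fixes X :: "'a::real_inner set"
  assumes dense: "\<And>p. p \<in> K \<Longrightarrow> \<exists>x\<in>X. dist p x \<le> \<rho>"
    and X: "X \<subseteq> K" and K: "convex K" and \<rho>: "0 < \<rho>" "128 * \<rho> \<le> r"
  obtains c where
    "\<And>\<sigma>. \<sigma> \<in> vietoris_rips X r \<Longrightarrow> \<sigma> \<noteq> {} \<Longrightarrow> c \<sigma> \<in> X"
    "\<And>\<sigma> \<tau> v. \<tau> \<in> vietoris_rips X r \<Longrightarrow> \<sigma> \<subseteq> \<tau> \<Longrightarrow> \<sigma> \<noteq> {} \<Longrightarrow> v \<in> \<tau> \<Longrightarrow> dist v (c \<sigma>) \<le> r"
    "\<And>\<sigma> \<tau>. \<tau> \<in> vietoris_rips X r \<Longrightarrow> \<sigma> \<subseteq> \<tau> \<Longrightarrow> \<sigma> \<noteq> {} \<Longrightarrow> dist (c \<sigma>) (c \<tau>) \<le> r - 2 * \<rho>"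
proof -
  define large where "large \<sigma> \<longleftrightarrow> (\<exists>a\<in>\<sigma>. \<exists>b\<in>\<sigma>. r / 2 \<le> dist a b)" for \<sigma> :: "'a set"
  have "\<exists>x. if large \<sigma> then \<exists>a\<in>\<sigma>. \<exists>b\<in>\<sigma>. r / 2 \<le> dist a b \<and> x \<in> X \<and> dist (midpoint a b) x \<le> \<rho>
            else x \<in> \<sigma>"
    if "\<sigma> \<subseteq> X" "\<sigma> \<noteq> {}" for \<sigma>
  proof (cases "large \<sigma>")
    case True
    then obtain a b where ab: "a \<in> \<sigma>" "b \<in> \<sigma>" "r / 2 \<le> dist a b"
      by (auto simp: large_def)
    then have "closed_segment a b \<subseteq> K"
      using X that(1) by (intro closed_segment_subset[OF _ _ K]) auto
    then have "midpoint a b \<in> K"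
      using midpoint_in_closed_segment by (rule subsetD)
    then show ?thesis
      using dense ab True by fastforce
  qed (use that in auto)
  then obtain c where c: "if large \<sigma> then \<exists>a\<in>\<sigma>. \<exists>b\<in>\<sigma>. r / 2 \<le> dist a b \<and> c \<sigma> \<in> X \<and> dist (midpoint a b) (c \<sigma>) \<le> \<rho>
            else c \<sigma> \<in> \<sigma>" if "\<sigma> \<subseteq> X" "\<sigma> \<noteq> {}" for \<sigma>
    by metis
  have r: "0 \<le> r" using \<rho> by simp
  have large: "\<exists>m. m \<in> convex hull \<sigma> \<and> dist m (c \<sigma>) \<le> \<rho> \<and> (\<forall>z. \<sigma> \<subseteq> cball z r \<longrightarrow> dist z m \<le> 31 / 32 * r)"
    if \<sigma>: "\<sigma> \<subseteq> X" "\<sigma> \<noteq> {}" "large \<sigma>" for \<sigma>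
  proof -
    obtain a b where ab: "a \<in> \<sigma>" "b \<in> \<sigma>" "r / 2 \<le> dist a b" "dist (midpoint a b) (c \<sigma>) \<le> \<rho>"
      using c[OF \<sigma>(1,2)] \<sigma>(3) by auto
    show ?thesis
    proof (intro exI conjI allI impI)
      show "midpoint a b \<in> convex hull \<sigma>"
        using ab by (intro midpoints_in_convex_hull)
           (auto simp: hull_inc)
      show "dist z (midpoint a b) \<le> 31 / 32 * r" if "\<sigma> \<subseteq> cball z r" for z
        using that ab r by (intro dist_midpoint_le) auto
    qed (use ab in auto)
  qed
  have hull: "convex hull \<sigma> \<subseteq> cball z s" if "\<sigma> \<subseteq> cball z s" for \<sigma> :: "'a set" and z s
    using that by (intro hull_minimal) auto
  have in_ball: "\<sigma> \<subseteq> cball v r" if "\<tau> \<in> vietoris_rips X r" "\<sigma> \<subseteq> \<tau>" "v \<in> \<tau>" for \<sigma> \<tau> v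
    using that by (auto simp: vietoris_rips_def)
  have sub: "\<sigma> \<subseteq> X" if "\<tau> \<in> vietoris_rips X r" "\<sigma> \<subseteq> \<tau>" for \<sigma> \<tau>
    using that by (auto simp: vietoris_rips_def)
  have near: "dist v (c \<sigma>) \<le> 31 / 32 * r + \<rho>"
    if prems: "\<tau> \<in> vietoris_rips X r" "\<sigma> \<subseteq> \<tau>" "\<sigma> \<noteq> {}" "v \<in> \<tau>" "large \<sigma>" for \<sigma> \<tau> v
  proof -
    obtain m where "dist m (c \<sigma>) \<le> \<rho>" "dist v m \<le> 31 / 32 * r"
      using large[OF sub[OF prems(1,2)] prems(3,5)] in_ball[OF prems(1,2,4)] by blast
    then show ?thesis
      using dist_triangle[of v "c \<sigma>" m] by simp
  qed
  show thesis
  proof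
    show "c \<sigma> \<in> X" if "\<sigma> \<in> vietoris_rips X r" "\<sigma> \<noteq> {}" for \<sigma>
      using c[of \<sigma>] that sub[OF that(1)] by (auto split: if_splits)
  next
    fix \<sigma> \<tau> v
    assume *: "\<tau> \<in> vietoris_rips X r" "\<sigma> \<subseteq> \<tau>" "\<sigma> \<noteq> {}" "v \<in> \<tau>"
    show "dist v (c \<sigma>) \<le> r"
    proof (cases "large \<sigma>")
      case True
      then show ?thesis using near[OF *] \<rho> by simp
    next
      case False
      then have "c \<sigma> \<in> \<sigma>" using c[of \<sigma>] sub * by auto
      then show ?thesis using in_ball[of \<tau> \<sigma> v] * by auto
    qed
  next
    fix \<sigma> \<tau>
    assume *: "\<tau> \<in> vietoris_rips X r" "\<sigma> \<subseteq> \<tau>" "\<sigma> \<noteq> {}"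
    then have "\<tau> \<noteq> {}" by auto
    show "dist (c \<sigma>) (c \<tau>) \<le> r - 2 * \<rho>"
    proof (cases "large \<tau>")
      case \<tau>: True
      show ?thesis
      proof (cases "large \<sigma>")
        case True
        obtain m where m: "m \<in> convex hull \<sigma>" "dist m (c \<sigma>) \<le> \<rho>"
          using large[OF sub[OF *(1,2)] *(3) True] by blast
        obtain m' where m': "dist m' (c \<tau>) \<le> \<rho>" "\<And>z. \<tau> \<subseteq> cball z r \<Longrightarrow> dist z m' \<le> 31 / 32 * r"
          using large[OF sub[OF *(1)] \<open>\<tau> \<noteq> {}\<close> \<tau>] by blast
        \<comment> \<open>The ball condition passes from the vertices of \<open>\<sigma>\<close> to the midpoint \<open>m\<close> in their convex hull.\<close>
        have "\<tau> \<subseteq> cball m r"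
        proof
          fix v assume "v \<in> \<tau>"
          then have "m \<in> cball v r"
            using hull[OF in_ball[OF *(1,2)]] m(1) by blast
          then show "v \<in> cball m r" by (simp add: dist_commute)
        qed
        then have "dist m m' \<le> 31 / 32 * r" by (rule m'(2))
        moreover have "dist (c \<sigma>) (c \<tau>) \<le> dist m (c \<sigma>) + dist m m' + dist m' (c \<tau>)"
          by metric
        ultimately show ?thesis using m m' \<rho> by simp
      next
        case False
        then have "c \<sigma> \<in> \<tau>" using c[of \<sigma>] sub * by auto
        then show ?thesis using near[OF *(1) order_refl \<open>\<tau> \<noteq> {}\<close> _ \<tau>] \<rho> by fastforce
      qed
    next
      case False
      then have "\<not> large \<sigma>" using * by (auto simp: large_def)
      then have "c \<sigma> \<in> \<tau>" "c \<tau> \<in> \<tau>"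
        using c[of \<sigma>] c[of \<tau>] sub * \<open>\<tau> \<noteq> {}\<close> False by auto
      then have "dist (c \<sigma>) (c \<tau>) < r / 2"
        using False by (force simp: large_def)
      then show ?thesis using \<rho> by simp
    qed
  qed
qed

text \<open>The homotopies are \<open>id \<simeq> h \<simeq> g \<circ> \<pi> \<circ> h \<simeq> const\<close>.  Here \<open>h\<close> is the simplicial map from the
  barycentric subdivision given by the face centres, \<open>\<pi>\<close> evaluates barycentric coordinates in the
  ambient space, and \<open>g\<close> is a partition of unity on \<open>K\<close> subordinate to the balls of radius
  \<open>2 * \<rho>\<close>.  Applying \<open>h\<close> first is essential: the vertices of \<open>g (\<pi> t)\<close> may be up to \<open>r + 2 * \<rho>\<close>
  away from those of \<open>t\<close>, and \<open>h\<close> creates the margin \<open>2 * \<rho>\<close> that makes the straight line from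
  \<open>h t\<close> to \<open>g (\<pi> (h t))\<close> stay in the complex.\<close>

theorem contractible_vietoris_rips_of_dense:
  fixes X K :: "'a::real_inner set"
  assumes fin: "finite X" and X: "X \<subseteq> K" and K: "convex K"
    and dense: "\<And>p. p \<in> K \<Longrightarrow> \<exists>x\<in>X. dist p x \<le> \<rho>"
    and \<rho>: "0 < \<rho>" "128 * \<rho> \<le> r"
  shows "contractible_space (geometric_realization (vietoris_rips X r))"
proof -
  let ?\<Delta> = "vietoris_rips X r"
  let ?R = "geometric_realization ?\<Delta>"
  obtain c where c: "\<And>\<sigma>. \<sigma> \<in> ?\<Delta> \<Longrightarrow> \<sigma> \<noteq> {} \<Longrightarrow> c \<sigma> \<in> X"
    and c_vertex: "\<And>\<sigma> \<tau> v. \<tau> \<in> ?\<Delta> \<Longrightarrow> \<sigma> \<subseteq> \<tau> \<Longrightarrow> \<sigma> \<noteq> {} \<Longrightarrow> v \<in> \<tau> \<Longrightarrow> dist v (c \<sigma>) \<le> r"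
    and c_chain: "\<And>\<sigma> \<tau>. \<tau> \<in> ?\<Delta> \<Longrightarrow> \<sigma> \<subseteq> \<tau> \<Longrightarrow> \<sigma> \<noteq> {} \<Longrightarrow> dist (c \<sigma>) (c \<tau>) \<le> r - 2 * \<rho>"
    using face_center_exists[OF dense X K \<rho>] by metis
  have R: "0 \<le> t v" "supp t \<in> ?\<Delta>" "(\<Sum>v\<in>supp t. t v) = 1" if "t \<in> topspace ?R" for t v
    using that by (auto simp: topspace_geometric_realization)
  have sub: "\<sigma> \<subseteq> X" if "\<sigma> \<in> ?\<Delta>" for \<sigma> using that by (simp add: vietoris_rips_def)
  have finite_faces: "\<And>\<sigma>. \<sigma> \<in> ?\<Delta> \<Longrightarrow> finite \<sigma>"
    using finite_vietoris_rips[OF fin] .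

  \<comment> \<open>Different level sets may share a centre, so their weights are added up.\<close>
  define w where "w t v = (\<Sum>\<sigma>\<in>{\<sigma> \<in> Pow X. \<sigma> \<noteq> {} \<and> c \<sigma> = v}. flag_weight X \<sigma> t)" for t v
  define h where "h t = normalized X (w t)" for t
  have w_nonneg: "0 \<le> w t v" for t v
    by (auto simp: w_def intro: sum_nonneg flag_weight_nonneg)
  have fin_idx: "finite {\<sigma> \<in> Pow X. \<sigma> \<noteq> {} \<and> c \<sigma> = v}" for v
    using fin by simp
  have w_pos_iff: "0 < w t v \<longleftrightarrow> (\<exists>\<sigma>\<subseteq>X. \<sigma> \<noteq> {} \<and> c \<sigma> = v \<and> 0 < flag_weight X \<sigma> t)" for t v
  proof -
    have "0 < w t v \<longleftrightarrow> w t v \<noteq> 0" using w_nonneg[of t v] by auto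
    also have "\<dots> \<longleftrightarrow> (\<exists>\<sigma>\<in>{\<sigma> \<in> Pow X. \<sigma> \<noteq> {} \<and> c \<sigma> = v}. flag_weight X \<sigma> t \<noteq> 0)"
      unfolding w_def by (subst sum_nonneg_eq_0_iff) (use fin_idx in \<open>auto simp: flag_weight_nonneg\<close>)
    also have "\<dots> \<longleftrightarrow> (\<exists>\<sigma>\<subseteq>X. \<sigma> \<noteq> {} \<and> c \<sigma> = v \<and> 0 < flag_weight X \<sigma> t)"
      using flag_weight_nonneg[of X _ t] by (auto simp: less_le)
    finally show ?thesis .
  qed
  have flag_supp: "\<sigma> \<subseteq> supp t" if "\<sigma> \<subseteq> X" "0 < flag_weight X \<sigma> t" for \<sigma> t
    using that fin by (force simp: flag_weight_pos_iff)
  have w_pos: "\<exists>v\<in>X. 0 < w t v" if t: "t \<in> topspace ?R" for t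
  proof -
    have "supp t \<noteq> {}" using R(3)[OF t] by force
    then have "\<exists>v\<in>X. 0 < t v"
      using R(1,2)[OF t] sub by (fastforce simp: less_le)
    then obtain \<sigma> where \<sigma>: "\<sigma> \<subseteq> X" "\<sigma> \<noteq> {}" "0 < flag_weight X \<sigma> t"
      using flag_weight_pos_exists[OF fin] by blast
    then have "c \<sigma> \<in> X"
      using c vietoris_rips_subset[OF R(2)[OF t]] flag_supp by blast
    then show ?thesis using \<sigma> w_pos_iff by blast
  qed
  have supp_h: "supp (h t) = {v \<in> X. 0 < w t v}" if "t \<in> topspace ?R" for t
    unfolding h_def using fin w_nonneg w_pos[OF that] by (rule supp_normalized)
  have h_diam: "dist x y \<le> r - 2 * \<rho>"
    if t: "t \<in> topspace ?R" and xy: "x \<in> supp (h t)" "y \<in> supp (h t)" for t x y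
  proof -
    obtain \<sigma> \<tau> where \<sigma>: "\<sigma> \<subseteq> X" "\<sigma> \<noteq> {}" "c \<sigma> = x" "0 < flag_weight X \<sigma> t"
      and \<tau>: "\<tau> \<subseteq> X" "\<tau> \<noteq> {}" "c \<tau> = y" "0 < flag_weight X \<tau> t"
      using xy unfolding supp_h[OF t] w_pos_iff by blast
    have "\<sigma> \<in> ?\<Delta>" "\<tau> \<in> ?\<Delta>"
      using vietoris_rips_subset[OF R(2)[OF t]] flag_supp \<sigma> \<tau> by blast+
    moreover have "\<sigma> \<subseteq> \<tau> \<or> \<tau> \<subseteq> \<sigma>"
      using flag_weight_chain fin \<sigma> \<tau> by blast
    ultimately show ?thesis
      using c_chain[of \<tau> \<sigma>] c_chain[of \<sigma> \<tau>] \<sigma> \<tau> by (auto simp: dist_commute)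
  qed
  have h_vertex: "dist v x \<le> r"
    if t: "t \<in> topspace ?R" and v: "v \<in> supp t" and x: "x \<in> supp (h t)" for t v x
  proof -
    obtain \<sigma> where \<sigma>: "\<sigma> \<subseteq> X" "\<sigma> \<noteq> {}" "c \<sigma> = x" "0 < flag_weight X \<sigma> t"
      using x unfolding supp_h[OF t] w_pos_iff by blast
    show ?thesis
      using c_vertex[OF R(2)[OF t] _ \<sigma>(2) v] flag_supp \<sigma> by blast
  qed
  have h_sub: "supp (h t) \<subseteq> X" if "t \<in> topspace ?R" for t
    using supp_h[OF that] by blast
  have h_face: "supp t \<union> supp (h t) \<in> ?\<Delta>" if t: "t \<in> topspace ?R" for t
    using R(2)[OF t] h_sub[OF t] h_diam[OF t] h_vertex[OF t] \<rho>
    by (fastforce simp: vietoris_rips_def dist_commute)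
  have h_cont: "continuous_map ?R ?R h"
    unfolding h_def
  proof (rule continuous_map_normalized[OF fin])
    show "continuous_map ?R euclideanreal (\<lambda>t. w t v)" for v
      unfolding w_def flag_weight_def using fin finite_subset[OF _ fin]
      by (intro continuous_map_sum continuous_map_prod continuous_map_real_mult
          continuous_map_real_max continuous_map_diff continuous_map_coordinate) auto
    show "{v \<in> X. 0 < w t v} \<in> ?\<Delta>" if "t \<in> topspace ?R" for t
      using vietoris_rips_subset[OF h_face[OF that] Un_upper2] supp_h[OF that] by simp
  qed (use w_nonneg w_pos in auto)
  \<comment> \<open>Every centre along the chain is within \<open>r\<close> of every vertex of the carrier of \<open>t\<close>.\<close>
  have id_h: "homotopic_with (\<lambda>_. True) ?R ?R id h"
    by (rule homotopic_straight_line) (use h_cont finite_faces h_face in auto)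

  define \<pi> where "\<pi> t = (\<Sum>v\<in>X. t v *\<^sub>R v)" for t :: "'a \<Rightarrow> real"
  have \<pi>_hull: "\<pi> t \<in> convex hull (supp t)" if t: "t \<in> topspace ?R" for t
  proof -
    have "\<pi> t = (\<Sum>v\<in>supp t. t v *\<^sub>R v)"
      unfolding \<pi>_def using fin sub[OF R(2)[OF t]] by (intro sum.mono_neutral_right) auto
    also have "\<dots> \<in> convex hull (supp t)"
      using R[OF t] finite_faces[OF R(2)[OF t]]
      by (intro convex_sum convex_convex_hull) (auto intro: hull_inc)
    finally show ?thesis .
  qed
  have \<pi>_cont: "continuous_map ?R (top_of_set K) \<pi>"
  proof (rule continuous_map_into_subtopology)
    show "continuous_map ?R euclidean \<pi>"
      unfolding \<pi>_def continuous_map_atin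
      using continuous_map_coordinate[of ?\<Delta>] 
      by (auto simp: continuous_map_atin intro!: tendsto_sum tendsto_scaleR)
    show "\<pi> \<in> topspace ?R \<rightarrow> K"
    proof
      fix t assume t: "t \<in> topspace ?R"
      have "convex hull supp t \<subseteq> K"
        using sub[OF R(2)[OF t]] X K by (intro hull_minimal) auto
      then show "\<pi> t \<in> K" using \<pi>_hull[OF t] by auto
    qed
  qed
  define u where "u p x = max 0 (2 * \<rho> - dist p x)" for p x :: 'a
  define g where "g p = normalized X (u p)" for p
  have u_pos: "\<exists>x\<in>X. 0 < u p x" if "p \<in> K" for p
    using dense[OF that] \<rho> by (force simp: u_def)
  have supp_g: "supp (g p) = {x \<in> X. dist p x < 2 * \<rho>}" if "p \<in> K" for p
    unfolding g_def by (subst supp_normalized[OF fin _ u_pos[OF that]]) (auto simp: u_def)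
  have g_cont: "continuous_map (top_of_set K) ?R g"
    unfolding g_def
  proof (rule continuous_map_normalized[OF fin])
    show "continuous_map (top_of_set K) euclideanreal (\<lambda>p. u p v)" for v
      unfolding u_def by (auto intro!: continuous_intros)
    show "{v \<in> X. 0 < u p v} \<in> ?\<Delta>" for p
    proof -
      have "dist x y \<le> r" if "dist p x < 2 * \<rho>" "dist p y < 2 * \<rho>" for x y
        using dist_triangle3[of x y p] that \<rho> by simp
      then show ?thesis
        by (auto simp: vietoris_rips_def u_def)
    qed
  qed (use u_pos in \<open>auto simp: u_def\<close>)
  have h_ghp: "homotopic_with (\<lambda>_. True) ?R ?R h (g \<circ> (\<pi> \<circ> h))"
  proof (rule homotopic_straight_line)
    show "continuous_map ?R ?R (g \<circ> (\<pi> \<circ> h))"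
      by (intro continuous_map_compose[OF _ g_cont] continuous_map_compose[OF h_cont \<pi>_cont])
    fix t assume t: "t \<in> topspace ?R"
    have ht: "h t \<in> topspace ?R"
      using h_cont t by (auto simp: continuous_map_def)
    have \<pi>K: "\<pi> (h t) \<in> K"
      using \<pi>_cont ht by (auto simp: continuous_map_def)
    have "dist (\<pi> (h t)) x \<le> r - 2 * \<rho>" if x: "x \<in> supp (h t)" for x
    proof -
      have "convex hull (supp (h t)) \<subseteq> cball x (r - 2 * \<rho>)"
        using h_diam[OF t x] by (intro hull_minimal) auto
      then show ?thesis
        using \<pi>_hull[OF ht] by (auto simp: dist_commute)
    qed
    note near = this
    have "dist x y \<le> r" if "x \<in> supp (h t)" "y \<in> supp (g (\<pi> (h t)))" for x y
    proof -
      have "dist (\<pi> (h t)) x \<le> r - 2 * \<rho>" using that(1) by (rule near)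
      moreover have "dist (\<pi> (h t)) y < 2 * \<rho>" using that(2) unfolding supp_g[OF \<pi>K] by simp
      ultimately show ?thesis using dist_triangle3[of x y "\<pi> (h t)"] by linarith
    qed
    moreover have "supp (g (\<pi> (h t))) \<in> ?\<Delta>"
      using g_cont \<pi>K by (auto simp: continuous_map_into_geometric_realization topspace_geometric_realization)
    moreover have "supp (h t) \<in> ?\<Delta>"
      using R(2)[OF ht] .
    ultimately show "supp (h t) \<union> supp ((g \<circ> (\<pi> \<circ> h)) t) \<in> ?\<Delta>"
      by (auto simp: vietoris_rips_def) (metis dist_commute)
  qed (use h_cont finite_faces in auto)
  have "contractible_space (top_of_set K)"
    using K by (auto simp: convex_imp_contractible)
  then obtain a where "homotopic_with (\<lambda>_. True) ?R ?R (g \<circ> (\<pi> \<circ> h)) (\<lambda>_. a)"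
    using nullhomotopic_through_contractible_space[OF continuous_map_compose[OF h_cont \<pi>_cont] g_cont]
    by blast
  then show ?thesis
    unfolding contractible_space_def
    using id_h h_ghp homotopic_with_trans by blast
qed

section \<open>Large balls inside a smooth convex body\<close>

text \<open>Near a boundary point with outer normal \<open>u\<close> the body looks like a half-space.  If the ball of
  radius \<open>\<rho> / 3\<close> about \<open>x - (\<rho> / 2) u\<close> left \<open>K\<close> for arbitrarily small \<open>\<rho>\<close>, normals separating
  \<open>K\<close> from the escaping points would have inner product at most \<open>2 / 3\<close> with \<open>u\<close>.  A limit of these
  normals supports \<open>K\<close> at \<open>x\<close>, hence equals \<open>u\<close> by uniqueness, although \<open>u \<bullet> u = 1\<close>.\<close>

lemma smooth_frontier_ball:
  fixes K :: "'a::euclidean_space set"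
  assumes K: "compact K" "convex K" and smooth: "smoothly_bounded K" and x: "x \<in> frontier K"
  shows "\<exists>\<rho>>0. \<exists>y. cball y (\<rho> / 3) \<subseteq> K \<and> dist x y \<le> \<rho> / 2"
proof -
  have xK: "x \<in> K"
    using x K frontier_subset_closed compact_imp_closed by blast
  obtain u where u: "norm u = 1"
    and uniq: "\<And>l. norm l = 1 \<Longrightarrow> (\<forall>z\<in>K. l \<bullet> z \<le> l \<bullet> x) \<Longrightarrow> l = u"
    using smooth x unfolding smoothly_bounded_def by blast
  define e where "e m = inverse (real (Suc m))" for m
  have e: "0 < e m" for m by (simp add: e_def)
  have e_lim: "e \<longlonglongrightarrow> 0"
    unfolding e_def by (rule LIMSEQ_inverse_real_of_nat)
  show ?thesis
  proof (rule ccontr)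
    assume none: "\<not> ?thesis"
    have "\<exists>p l. p \<in> cball (x - (e m / 2) *\<^sub>R u) (e m / 3) \<and> norm l = 1 \<and> (\<forall>z\<in>K. l \<bullet> z < l \<bullet> p)" for m
    proof -
      have "dist x (x - (e m / 2) *\<^sub>R u) \<le> e m / 2"
        using u e[of m] by (simp add: dist_norm)
      then obtain p where p: "p \<in> cball (x - (e m / 2) *\<^sub>R u) (e m / 3)" "p \<notin> K"
        using none e[of m] by blast
      obtain a b where ab: "a \<bullet> p < b" "\<forall>z\<in>K. b < a \<bullet> z"
        using separating_hyperplane_closed_point[OF K(2) compact_imp_closed[OF K(1)] p(2)] by blast
      have "a \<noteq> 0" using ab xK by force
      have "sgn (- a) \<bullet> z < sgn (- a) \<bullet> p" if "z \<in> K" for z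
      proof -
        have "a \<bullet> p < a \<bullet> z" using ab that by force
        then show ?thesis using \<open>a \<noteq> 0\<close> by (simp add: sgn_div_norm)
      qed
      then show ?thesis using p(1) \<open>a \<noteq> 0\<close> by (metis neg_equal_0_iff_equal norm_sgn)
    qed
    then obtain p l where p: "\<And>m. p m \<in> cball (x - (e m / 2) *\<^sub>R u) (e m / 3)"
      and l: "\<And>m. norm (l m) = 1" and sep: "\<And>m z. z \<in> K \<Longrightarrow> l m \<bullet> z < l m \<bullet> p m"
      by metis
    \<comment> \<open>The separating hyperplane has \<open>x\<close> on one side and \<open>p m\<close> on the other.\<close>
    have lu: "l m \<bullet> u \<le> 2 / 3" for m
    proof -
      let ?w = "p m - (x - (e m / 2) *\<^sub>R u)"
      have "l m \<bullet> ?w \<le> norm (l m) * norm ?w"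
        by (rule norm_cauchy_schwarz)
      also have "\<dots> \<le> e m / 3"
        using p[of m] l[of m] by (simp add: dist_norm norm_minus_commute)
      finally have "l m \<bullet> p m - l m \<bullet> x + e m / 2 * (l m \<bullet> u) \<le> e m / 3"
        by (simp add: inner_diff_right)
      then have "e m / 2 * (l m \<bullet> u) \<le> e m / 2 * (2 / 3)"
        using sep[OF xK, of m] by linarith
      then show ?thesis
        using e[of m] by (subst (asm) mult_le_cancel_left_pos) auto
    qed
    have "p \<longlonglongrightarrow> x"
    proof (rule Lim_transform_bound[of "\<lambda>m. p m - x" e, THEN Lim_null[THEN iffD2]])
      have "norm (p m - x) \<le> e m" for m
      proof -
        have "norm (p m - x) \<le> dist (x - (e m / 2) *\<^sub>R u) (p m) + norm ((e m / 2) *\<^sub>R u)"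
          unfolding dist_norm using norm_triangle_sub[of "p m - x" "- ((e m / 2) *\<^sub>R u)"]
          by (simp add: norm_minus_commute algebra_simps)
        also have "\<dots> \<le> e m / 3 + e m / 2"
          using p[of m] u e[of m] by simp
        finally show ?thesis using e[of m] by simp
      qed
      then show "\<forall>\<^sub>F m in sequentially. norm (p m - x) \<le> norm (e m)"
        by (intro always_eventually allI order_trans[OF _ abs_ge_self[of "e _", folded real_norm_def]])
    qed (rule e_lim)
    obtain L \<phi> where \<phi>: "strict_mono \<phi>" "(l \<circ> \<phi>) \<longlonglongrightarrow> L" and L: "norm L = 1"
      using compact_sphere[of "0::'a" 1] l unfolding compact_def by (metis dist_0_norm mem_sphere)
    have "L \<bullet> z \<le> L \<bullet> x" if "z \<in> K" for z
    proof (rule LIMSEQ_le)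
      show "(\<lambda>m. (l \<circ> \<phi>) m \<bullet> z) \<longlonglongrightarrow> L \<bullet> z"
        by (intro tendsto_intros \<phi>)
      show "(\<lambda>m. (l \<circ> \<phi>) m \<bullet> (p \<circ> \<phi>) m) \<longlonglongrightarrow> L \<bullet> x"
        by (intro tendsto_inner \<phi> LIMSEQ_subseq_LIMSEQ \<open>p \<longlonglongrightarrow> x\<close>)
      show "\<exists>N. \<forall>m\<ge>N. (l \<circ> \<phi>) m \<bullet> z \<le> (l \<circ> \<phi>) m \<bullet> (p \<circ> \<phi>) m"
        using sep[OF that] by (auto intro: less_imp_le)
    qed
    then have "L = u" using uniq L by blast
    moreover have "L \<bullet> u \<le> 2 / 3"
    proof (rule LIMSEQ_le_const2)
      show "(\<lambda>m. (l \<circ> \<phi>) m \<bullet> u) \<longlonglongrightarrow> L \<bullet> u"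
        by (intro tendsto_intros \<phi>)
    qed (use lu in auto)
    ultimately show False
      using u by (simp add: dot_square_norm)
  qed
qed

text \<open>The homothety with centre \<open>x\<close> and ratio \<open>\<rho>' / \<rho>\<close> maps \<open>K\<close> into itself.\<close>

lemma convex_shrink_ball:
  fixes K :: "'a::euclidean_space set"
  assumes K: "convex K" "x \<in> K" and y: "cball y (a * \<rho>) \<subseteq> K \<inter> cball x \<rho>"
    and \<rho>': "0 < \<rho>'" "\<rho>' \<le> \<rho>"
  shows "\<exists>y'. cball y' (a * \<rho>') \<subseteq> K \<inter> cball x \<rho>'"
proof -
  define t where "t = \<rho>' / \<rho>"
  have t: "0 < t" "t \<le> 1" "t * \<rho> = \<rho>'" using \<rho>' by (auto simp: t_def)
  have "w \<in> K \<inter> cball x \<rho>'" if w: "w \<in> cball (x + t *\<^sub>R (y - x)) (a * \<rho>')" for w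
  proof -
    define w0 where "w0 = x + (1 / t) *\<^sub>R (w - x)"
    have w_eq: "w = (1 - t) *\<^sub>R x + t *\<^sub>R w0"
      using t(1) by (simp add: w0_def algebra_simps)
    have "x + t *\<^sub>R (y - x) - w = t *\<^sub>R (y - w0)"
      unfolding w_eq by (simp add: algebra_simps)
    then have "t * dist y w0 \<le> t * (a * \<rho>)"
      using w t by (simp add: dist_norm mult.left_commute)
    then have "w0 \<in> cball y (a * \<rho>)"
      using t(1) by simp
    then have w0: "w0 \<in> K" "dist x w0 \<le> \<rho>" using y by auto
    have "w \<in> K"
      unfolding w_eq using K w0 t by (intro convexD) auto
    moreover have "x - w = t *\<^sub>R (x - w0)"
      unfolding w_eq by (simp add: algebra_simps)
    then have "dist x w = t * dist x w0"
      using t(1) by (simp add: dist_norm)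
    then have "dist x w \<le> \<rho>'"
      using w0(2) t by (metis mult_left_mono less_imp_le)
    ultimately show ?thesis by simp
  qed
  then show ?thesis by blast
qed

text \<open>The only consequence of smoothness in the proof.  The fraction \<open>1 / 4\<close> of the radius is the same
  for all smooth bodies, so the ball \<open>cball x \<rho>\<close> around a sample location always meets \<open>K\<close> in a fixed
  fraction of its volume; at the sharp corners of a general convex body this fraction can be
  arbitrarily small.  Passing from \<open>1 / 3\<close>
  at single points to \<open>1 / 4\<close> leaves room for the compactness argument.\<close>

theorem smooth_body_uniform_balls:
  fixes K :: "'a::euclidean_space set"
  assumes body: "convex_body K" and smooth: "smoothly_bounded K"
  shows "\<exists>\<rho>0>0. \<forall>x\<in>K. \<forall>\<rho>. 0 < \<rho> \<longrightarrow> \<rho> \<le> \<rho>0 \<longrightarrow> (\<exists>y. cball y (\<rho> / 4) \<subseteq> K \<inter> cball x \<rho>)"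
proof -
  have K: "compact K" "convex K"
    using body by (auto simp: convex_body_def)
  have "\<exists>\<rho> y. 0 < \<rho> \<and> cball y (\<rho> / 3) \<subseteq> K \<and> dist x y \<le> \<rho> / 2" if "x \<in> K" for x
  proof (cases "x \<in> frontier K")
    case True
    then show ?thesis using smooth_frontier_ball[OF K smooth] by blast
  next
    case False
    then have "x \<in> interior K"
      using that closure_subset by (force simp: frontier_def)
    then obtain d where "0 < d" "cball x d \<subseteq> K"
      using mem_interior_cball by blast
    then show ?thesis
      by (intro exI[of _ "3 * d"] exI[of _ x]) auto
  qed
  then obtain R Y where R: "\<And>x. x \<in> K \<Longrightarrow> 0 < R x"
    and Y: "\<And>x. x \<in> K \<Longrightarrow> cball (Y x) (R x / 3) \<subseteq> K" "\<And>x. x \<in> K \<Longrightarrow> dist x (Y x) \<le> R x / 2"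
    by metis
  have "K \<subseteq> (\<Union>x\<in>K. ball x (R x / 12))"
    using R by force
  then obtain F where F: "F \<subseteq> K" "finite F" "K \<subseteq> (\<Union>x\<in>F. ball x (R x / 12))"
    using compactE_image[OF K(1), of K "\<lambda>x. ball x (R x / 12)"] by auto
  have "K \<noteq> {}"
    using body interior_subset by (force simp: convex_body_def)
  then have "F \<noteq> {}" using F(3) by auto
  define \<rho>0 where "\<rho>0 = Min (R ` F)"
  have "0 < \<rho>0"
    unfolding \<rho>0_def using F R \<open>F \<noteq> {}\<close> by (subst Min_gr_iff) auto
  moreover have "\<exists>y. cball y (\<rho> / 4) \<subseteq> K \<inter> cball x \<rho>" if x: "x \<in> K" and \<rho>: "0 < \<rho>" "\<rho> \<le> \<rho>0" for x \<rho>
  proof -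
    \<comment> \<open>\<open>1/4 + 1/12 + 1/2 \<le> 1\<close>: the ball of a nearby centre \<open>z\<close> also lies in \<open>cball x (R z)\<close>.\<close>
    obtain z where z: "z \<in> F" "dist z x < R z / 12" using F(3) x by auto
    have zK: "z \<in> K" using z F by auto
    have "\<rho>0 \<le> R z" unfolding \<rho>0_def using z F by auto
    have "w \<in> K \<inter> cball x (R z)" if w: "w \<in> cball (Y z) (1/4 * R z)" for w
    proof -
      have "w \<in> cball (Y z) (R z / 3)" using w R[OF zK] by simp
      moreover have "dist x w \<le> dist z x + dist z (Y z) + dist (Y z) w"
        by metric
      ultimately show ?thesis
        using Y[OF zK] z w R[OF zK] by auto
    qed
    then have "cball (Y z) (1/4 * R z) \<subseteq> K \<inter> cball x (R z)" by blast
    from convex_shrink_ball[OF K(2) x this \<rho>(1)] \<rho>(2) \<open>\<rho>0 \<le> R z\<close> show ?thesis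
      by simp
  qed
  ultimately show ?thesis by blast
qed

text \<open>A separated subset \<open>S\<close> of maximal cardinality.  The balls assigned to its points are
  disjoint subsets of \<open>K\<close>, so volume bounds the cardinality.\<close>

lemma packing_net:
  fixes K :: "'a::euclidean_space set"
  assumes K: "compact K" and \<rho>: "0 < \<rho>"
    and balls: "\<And>x. x \<in> K \<Longrightarrow> cball (y x) (\<rho> / 4) \<subseteq> K \<inter> cball x \<rho>"
  obtains S where "finite S" "S \<subseteq> K" "real (card S) * measure lborel (cball (0::'a) (\<rho> / 4)) \<le> measure lborel K"
    "\<And>p. p \<in> K \<Longrightarrow> \<exists>s\<in>S. dist p s \<le> 2 * \<rho>"
proof -
  let ?m = "measure lborel (cball (0::'a) (\<rho> / 4))"
  have m: "0 < ?m" using \<rho> by simp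
  define P where "P S \<longleftrightarrow> finite S \<and> S \<subseteq> K \<and> (\<forall>s\<in>S. \<forall>s'\<in>S. s \<noteq> s' \<longrightarrow> 2 * \<rho> < dist s s')" for S
  have bound: "real (card S) * ?m \<le> measure lborel K" if "P S" for S
  proof -
    have S: "finite S" "S \<subseteq> K" "\<And>s s'. s \<in> S \<Longrightarrow> s' \<in> S \<Longrightarrow> s \<noteq> s' \<Longrightarrow> 2 * \<rho> < dist s s'"
      using that by (auto simp: P_def)
    have "disjoint_family_on (\<lambda>s. cball (y s) (\<rho> / 4)) S"
    proof (unfold disjoint_family_on_def, intro ballI impI)
      fix s s' assume s: "s \<in> S" "s' \<in> S" "s \<noteq> s'"
      have "2 * \<rho> < dist s s'" using S(3) s by blast
      moreover have "w \<in> cball s \<rho>" "w \<in> cball s' \<rho>"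
        if "w \<in> cball (y s) (\<rho> / 4)" "w \<in> cball (y s') (\<rho> / 4)" for w
        using that balls[of s] balls[of s'] s S(2) by blast+
      ultimately have False
        if "w \<in> cball (y s) (\<rho> / 4)" "w \<in> cball (y s') (\<rho> / 4)" for w
        using that dist_triangle2[of s s' w] by fastforce
      then show "cball (y s) (\<rho> / 4) \<inter> cball (y s') (\<rho> / 4) = {}"
        by blast
    qed
    then have "measure lborel (\<Union>s\<in>S. cball (y s) (\<rho> / 4)) = (\<Sum>s\<in>S. measure lborel (cball (y s) (\<rho> / 4)))"
      using S(1) \<rho> by (intro measure_finite_Union) (auto simp: emeasure_cball)
    also have "\<dots> = real (card S) * ?m"
      using \<rho> by (simp add: content_cball)
    finally have "real (card S) * ?m = measure lborel (\<Union>s\<in>S. cball (y s) (\<rho> / 4))" ..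
    also have "\<dots> \<le> measure lborel K"
    proof (rule measure_mono_fmeasurable)
      show "(\<Union>s\<in>S. cball (y s) (\<rho> / 4)) \<subseteq> K" using balls S(2) by blast
      show "(\<Union>s\<in>S. cball (y s) (\<rho> / 4)) \<in> sets lborel" using S(1) by auto
      show "K \<in> fmeasurable lborel" using K by (rule fmeasurable_compact)
    qed
    finally show ?thesis .
  qed
  have "P {}" by (simp add: P_def)
  moreover have "card S < Suc (nat \<lfloor>measure lborel K / ?m\<rfloor>)" if "P S" for S
    using bound[OF that] m by (simp add: less_Suc_eq_le le_nat_floor pos_le_divide_eq)
  ultimately obtain S where S: "P S" and max: "\<And>S'. P S' \<Longrightarrow> card S' \<le> card S"
    using ex_has_greatest_nat[of P "{}" card] by (metis less_imp_le_nat)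
  show thesis
  proof
    show "\<exists>s\<in>S. dist p s \<le> 2 * \<rho>" if "p \<in> K" for p
    proof (rule ccontr)
      assume far: "\<not> ?thesis"
      then have "p \<notin> S" using \<rho> by (force)
      moreover have "P (insert p S)"
        using S far that by (auto simp: P_def dist_commute not_le)
      ultimately show False
        using max[of "insert p S"] S by (simp add: P_def)
    qed
  qed (use S bound in \<open>auto simp: P_def\<close>)
qed

section \<open>The connectivity event is measurable\<close>

lemma k_connected_retract:
  assumes T: "k_connected k T" and p: "continuous_map T T' p" and q: "continuous_map T' T q"
    and pq: "\<And>x. x \<in> topspace T' \<Longrightarrow> p (q x) = x"
  shows "k_connected k T'"
  unfolding k_connected_def
proof (intro allI impI)
  fix i f assume i: "i \<le> k" and f: "continuous_map (nsphere i) T' f"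
  obtain c where "homotopic_with (\<lambda>_. True) (nsphere i) T (q \<circ> f) (\<lambda>_. c)"
    using T i continuous_map_compose[OF f q] unfolding k_connected_def by blast
  then have "homotopic_with (\<lambda>_. True) (nsphere i) T' (p \<circ> (q \<circ> f)) (p \<circ> (\<lambda>_. c))"
    by (rule homotopic_with_compose_continuous_map_left[OF _ p]) simp
  then have "homotopic_with (\<lambda>_. True) (nsphere i) T' f (\<lambda>_. p c)"
    by (rule homotopic_with_eq)
      (use continuous_map_funspace[OF f] pq in \<open>auto simp: Pi_iff\<close>)
  then show "\<exists>c. homotopic_with (\<lambda>_. True) (nsphere i) T' f (\<lambda>_. c)" by blast
qed

lemma k_connected_contractible:
  assumes "contractible_space T"
  shows "k_connected k T"
  unfolding k_connected_def
  using nullhomotopic_into_contractible_space[OF _ assms] by metis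

definition relabel :: "'b set \<Rightarrow> ('b \<Rightarrow> 'a) \<Rightarrow> ('a \<Rightarrow> real) \<Rightarrow> 'b \<Rightarrow> real" where
  "relabel Y \<psi> t = (\<lambda>v. if v \<in> Y then t (\<psi> v) else 0)"

lemma continuous_map_relabel:
  assumes \<psi>: "bij_betw \<psi> Y X"
    and dist: "\<And>x y. x \<in> Y \<Longrightarrow> y \<in> Y \<Longrightarrow> dist (\<psi> x) (\<psi> y) \<le> r \<Longrightarrow> dist x y \<le> r"
  shows "continuous_map (geometric_realization (vietoris_rips X r))
    (geometric_realization (vietoris_rips Y r)) (relabel Y \<psi>)"
proof -
  have "continuous_map (geometric_realization (vietoris_rips X r)) euclideanreal (\<lambda>t. relabel Y \<psi> t v)" for v
    by (cases "v \<in> Y") (simp_all add: relabel_def continuous_map_coordinate)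
  moreover have "relabel Y \<psi> t \<in> topspace (geometric_realization (vietoris_rips Y r))"
    if "t \<in> topspace (geometric_realization (vietoris_rips X r))" for t
  proof -
    have t: "\<And>v. 0 \<le> t v" "supp t \<in> vietoris_rips X r" "(\<Sum>v\<in>supp t. t v) = 1"
      using that by (auto simp: topspace_geometric_realization)
    have s: "supp (relabel Y \<psi> t) = {v \<in> Y. t (\<psi> v) \<noteq> 0}"
      by (auto simp: relabel_def)
    have "supp t \<subseteq> X" using t(2) by (simp add: vietoris_rips_def)
    then have bij: "bij_betw \<psi> (supp (relabel Y \<psi> t)) (supp t)"
      unfolding s using \<psi> by (force simp: bij_betw_def inj_on_def)
    have "(\<Sum>v\<in>supp (relabel Y \<psi> t). relabel Y \<psi> t v) = (\<Sum>v\<in>supp (relabel Y \<psi> t). t (\<psi> v))"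
      by (rule sum.cong) (auto simp: relabel_def)
    also have "\<dots> = 1"
      using sum.reindex_bij_betw[OF bij, of t] t(3) by simp
    finally have "(\<Sum>v\<in>supp (relabel Y \<psi> t). relabel Y \<psi> t v) = 1" .
    moreover have "supp (relabel Y \<psi> t) \<in> vietoris_rips Y r"
      using t(2) dist unfolding s by (auto simp: vietoris_rips_def)
    moreover have "0 \<le> relabel Y \<psi> t v" for v
      using t(1) by (simp add: relabel_def)
    ultimately show ?thesis
      by (simp add: topspace_geometric_realization)
  qed
  ultimately show ?thesis
    by (simp add: continuous_map_into_geometric_realization)
qed

text \<open>The Rips complex is determined up to isomorphism by which sample points coincide and which are
  within distance \<open>r\<close>.  Coincidences have to be recorded because the vertex set is the image of
  the sample.\<close>

lemma k_connected_vietoris_rips_relabel: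
  fixes \<omega> \<omega>' :: "'i \<Rightarrow> 'a::metric_space"
  assumes eq: "\<And>i j. i \<in> I \<Longrightarrow> j \<in> I \<Longrightarrow> \<omega> i = \<omega> j \<longleftrightarrow> \<omega>' i = \<omega>' j"
    and dist: "\<And>i j. i \<in> I \<Longrightarrow> j \<in> I \<Longrightarrow> dist (\<omega> i) (\<omega> j) \<le> r \<longleftrightarrow> dist (\<omega>' i) (\<omega>' j) \<le> r"
    and conn: "k_connected k (geometric_realization (vietoris_rips (\<omega> ` I) r))"
  shows "k_connected k (geometric_realization (vietoris_rips (\<omega>' ` I) r))"
proof -
  define \<psi> where "\<psi> y = \<omega> (inv_into I \<omega>' y)" for y
  define \<phi> where "\<phi> x = \<omega>' (inv_into I \<omega> x)" for x
  have \<psi>: "\<psi> (\<omega>' i) = \<omega> i" if "i \<in> I" for i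
    unfolding \<psi>_def using that eq[of "inv_into I \<omega>' (\<omega>' i)" i]
    by (simp add: f_inv_into_f inv_into_into)
  have \<phi>: "\<phi> (\<omega> i) = \<omega>' i" if "i \<in> I" for i
    unfolding \<phi>_def using that eq[of "inv_into I \<omega> (\<omega> i)" i]
    by (simp add: f_inv_into_f inv_into_into)
  have "bij_betw \<psi> (\<omega>' ` I) (\<omega> ` I)" "bij_betw \<phi> (\<omega> ` I) (\<omega>' ` I)"
    by (rule bij_betw_byWitness[of _ \<phi>] bij_betw_byWitness[of _ \<psi>]; use \<psi> \<phi> in auto)+
  note bij = this
  show ?thesis
  proof (rule k_connected_retract[OF conn])
    show "continuous_map (geometric_realization (vietoris_rips (\<omega> ` I) r))
        (geometric_realization (vietoris_rips (\<omega>' ` I) r)) (relabel (\<omega>' ` I) \<psi>)"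
      using bij(1) by (rule continuous_map_relabel) (use \<psi> dist in auto)
    show "continuous_map (geometric_realization (vietoris_rips (\<omega>' ` I) r))
        (geometric_realization (vietoris_rips (\<omega> ` I) r)) (relabel (\<omega> ` I) \<phi>)"
      using bij(2) by (rule continuous_map_relabel) (use \<phi> dist in auto)
    fix t assume "t \<in> topspace (geometric_realization (vietoris_rips (\<omega>' ` I) r))"
    then have "supp t \<subseteq> \<omega>' ` I"
      by (simp add: topspace_geometric_realization vietoris_rips_def)
    then show "relabel (\<omega>' ` I) \<psi> (relabel (\<omega> ` I) \<phi> t) = t"
      using \<psi> \<phi> by (force simp: relabel_def fun_eq_iff)
  qed
qed

lemma sets_iid_uniform: "sets (iid_uniform K) = sets (Pi\<^sub>M UNIV (\<lambda>_. borel))"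
  unfolding iid_uniform_def by (intro sets_PiM_cong) auto

lemma space_iid_uniform: "space (iid_uniform K) = UNIV"
  by (simp add: iid_uniform_def space_PiM PiE_UNIV_domain)

lemma measurable_iid_uniform_component [measurable]:
  "(\<lambda>\<omega>. \<omega> i) \<in> borel_measurable (iid_uniform K)"
  unfolding measurable_cong_sets[OF sets_iid_uniform refl]
  by (rule measurable_component_singleton) simp

text \<open>Connectivity only depends on a finite pattern of coincidences and distances, so the event is a
  finite union of sets defined by finitely many equations and inequalities between coordinates.\<close>

lemma sets_k_connected_event:
  fixes K :: "'a::euclidean_space set"
  assumes I: "finite I"
  shows "{\<omega> \<in> space (iid_uniform K). k_connected k (geometric_realization (vietoris_rips (\<omega> ` I) r))}
    \<in> sets (iid_uniform K)"
proof -
  let ?M = "iid_uniform K"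
  define Q where "Q \<omega> \<longleftrightarrow> k_connected k (geometric_realization (vietoris_rips (\<omega> ` I) r))" for \<omega> :: "nat \<Rightarrow> 'a"
  define pat where "pat \<omega> = ({(i, j) \<in> I \<times> I. \<omega> i = \<omega> j}, {(i, j) \<in> I \<times> I. dist (\<omega> i) (\<omega> j) \<le> r})"
    for \<omega> :: "nat \<Rightarrow> 'a"
  have Q: "Q \<omega>'" if "pat \<omega> = pat \<omega>'" "Q \<omega>" for \<omega> \<omega>'
  proof -
    have "\<omega> i = \<omega> j \<longleftrightarrow> \<omega>' i = \<omega>' j"
      and "dist (\<omega> i) (\<omega> j) \<le> r \<longleftrightarrow> dist (\<omega>' i) (\<omega>' j) \<le> r" if "i \<in> I" "j \<in> I" for i j
      using \<open>pat \<omega> = pat \<omega>'\<close> that by (auto simp: pat_def set_eq_iff)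
    then show ?thesis
      using that(2) unfolding Q_def by (rule k_connected_vietoris_rips_relabel)
  qed
  have range: "range pat \<subseteq> Pow (I \<times> I) \<times> Pow (I \<times> I)"
    by (auto simp: pat_def)
  have "finite (range pat)"
    by (rule finite_subset[OF range]) (use I in simp)
  then have fin: "finite (pat ` {\<omega>. Q \<omega>})"
    by (rule finite_subset[rotated]) auto
  have pat_sets: "{\<omega> \<in> space ?M. pat \<omega> = d} \<in> sets ?M" if dr: "d \<in> range pat" for d
  proof -
    obtain A B where d: "d = (A, B)" "A \<subseteq> I \<times> I" "B \<subseteq> I \<times> I"
      using subsetD[OF range dr] by (cases d) auto
    have close [measurable]: "Measurable.pred ?M (\<lambda>\<omega>. dist (\<omega> i) (\<omega> j) \<le> s)" for i j s
      by measurable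
    \<comment> \<open>Equality of points is the case \<open>s = 0\<close>.\<close>
    have same [measurable]: "Measurable.pred ?M (\<lambda>\<omega>. \<omega> i = \<omega> j)" for i j
      using close[of i j 0] by simp
    have "Measurable.pred ?M (\<lambda>\<omega>. (\<omega> i = \<omega> j \<longleftrightarrow> (i, j) \<in> A) \<and>
        (dist (\<omega> i) (\<omega> j) \<le> r \<longleftrightarrow> (i, j) \<in> B))" for i j
      by (cases "(i, j) \<in> A"; cases "(i, j) \<in> B"; simp; measurable)
    then have "{\<omega> \<in> space ?M. \<forall>i\<in>I. \<forall>j\<in>I. (\<omega> i = \<omega> j \<longleftrightarrow> (i, j) \<in> A) \<and>
        (dist (\<omega> i) (\<omega> j) \<le> r \<longleftrightarrow> (i, j) \<in> B)} \<in> sets ?M"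
      using I by (intro sets.sets_Collect_finite_All) (auto simp: pred_def)
    moreover have "pat \<omega> = d \<longleftrightarrow> (\<forall>i\<in>I. \<forall>j\<in>I. (\<omega> i = \<omega> j \<longleftrightarrow> (i, j) \<in> A) \<and>
        (dist (\<omega> i) (\<omega> j) \<le> r \<longleftrightarrow> (i, j) \<in> B))" for \<omega>
      using d by (auto simp: pat_def)
    ultimately show ?thesis by simp
  qed
  have "{\<omega> \<in> space ?M. Q \<omega>} = (\<Union>d\<in>pat ` {\<omega>. Q \<omega>}. {\<omega> \<in> space ?M. pat \<omega> = d})"
  proof -
    have "Q \<omega> \<longleftrightarrow> pat \<omega> \<in> pat ` {\<omega>. Q \<omega>}" for \<omega>
      using Q[of _ \<omega>] by fastforce
    then show ?thesis by blast
  qed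
  also have "\<dots> \<in> sets ?M"
    using fin pat_sets by (intro sets.finite_UN) auto
  finally show ?thesis by (simp add: Q_def)
qed

section \<open>The random sample\<close>

lemma convex_body_volume:
  fixes K :: "'a::euclidean_space set"
  assumes "convex_body K"
  shows "K \<in> sets lborel" "emeasure lborel K \<noteq> 0" "emeasure lborel K \<noteq> \<infinity>" "0 < measure lborel K"
proof -
  have K: "compact K" using assms by (simp add: convex_body_def)
  show "K \<in> sets lborel" using K by (simp add: borel_compact)
  show fin: "emeasure lborel K \<noteq> \<infinity>" using emeasure_compact_finite[OF K] by simp
  obtain x e where "0 < e" "ball x e \<subseteq> K"
    using assms by (auto simp: convex_body_def mem_interior)
  then have "emeasure lborel (ball x e) \<le> emeasure lborel K" "0 < measure lborel (ball x e)"
    using K by (auto intro: emeasure_mono simp: borel_compact)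
  then show pos: "emeasure lborel K \<noteq> 0"
    by (auto simp: measure_def)
  show "0 < measure lborel K"
    using pos fin by (simp add: measure_def enn2real_positive_iff less_top zero_less_iff_neq_zero)
qed

lemma (in prob_space) iid_miss_all:
  assumes "finite J" "A \<in> sets M"
  shows "measure (Pi\<^sub>M (UNIV :: 'i set) (\<lambda>_. M)) {\<omega> \<in> space (Pi\<^sub>M UNIV (\<lambda>_. M)). \<forall>i\<in>J. \<omega> i \<notin> A}
    = (1 - prob A) ^ card J"
proof -
  note compl = prob_compl[OF assms(2)]
  interpret product_prob_space "\<lambda>_. M" "UNIV :: 'i set"
    by unfold_locales
  have "{\<omega> \<in> space (Pi\<^sub>M UNIV (\<lambda>_. M)). \<forall>i\<in>J. \<omega> i \<notin> A}
      = prod_emb UNIV (\<lambda>_. M) J (Pi\<^sub>E J (\<lambda>_. space M - A))"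
    by (auto simp: prod_emb_def space_PiM PiE_iff)
  also have "measure (Pi\<^sub>M UNIV (\<lambda>_. M)) \<dots> = (\<Prod>i\<in>J. measure M (space M - A))"
    using assms by (intro measure_PiM_emb) auto
  also have "\<dots> = (1 - measure M A) ^ card J"
    by (simp add: compl)
  finally show ?thesis .
qed

text \<open>A union bound over a packing net \<open>S\<close> of scale \<open>\<rho>\<close>.  With \<open>q\<close> the probability that one
  sample point falls into a given ball of radius \<open>\<rho> / 4\<close> inside \<open>K\<close>, disjointness of the balls
  gives \<open>card S \<le> 1 / q\<close>, and each ball is missed with probability \<open>(1 - q)\<^sup>n\<close>.  If no ball is
  missed, every point of \<open>K\<close> is within \<open>2 * \<rho> + \<rho>\<close> of the sample, and
  \<open>384 = 3 * 128\<close> makes the Rips complex contractible.\<close>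

lemma prob_k_connected_ge:
  fixes K :: "'a::euclidean_space set"
  assumes body: "convex_body K" and \<rho>: "0 < \<rho>" and r: "384 * \<rho> \<le> r"
    and balls: "\<And>x. x \<in> K \<Longrightarrow> \<exists>y. cball y (\<rho> / 4) \<subseteq> K \<inter> cball x \<rho>"
    and q: "q = measure lborel (cball (0::'a) (\<rho> / 4)) / measure lborel K"
  shows "1 - exp (- (q * real n)) / q
    \<le> \<P>(\<omega> in iid_uniform K. k_connected k (geometric_realization (vietoris_rips (\<omega> ` {1..n}) r)))"
proof -
  let ?U = "uniform_measure lborel K" and ?M = "iid_uniform K"
  note vol = convex_body_volume[OF body]
  interpret U: prob_space ?U
    using vol by (intro prob_space_uniform_measure)
  have M_eq: "?M = Pi\<^sub>M UNIV (\<lambda>_. ?U)" by (simp add: iid_uniform_def)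
  interpret M: prob_space ?M
    unfolding M_eq by (intro prob_space_PiM U.prob_space_axioms)
  have K: "compact K" "convex K" using body by (auto simp: convex_body_def)
  obtain y where y: "\<And>x. x \<in> K \<Longrightarrow> cball (y x) (\<rho> / 4) \<subseteq> K \<inter> cball x \<rho>"
    using balls by metis
  obtain S where S: "finite S" "S \<subseteq> K"
    and card: "real (card S) * measure lborel (cball (0::'a) (\<rho> / 4)) \<le> measure lborel K"
    and net: "\<And>p. p \<in> K \<Longrightarrow> \<exists>s\<in>S. dist p s \<le> 2 * \<rho>"
    using packing_net[OF K(1) \<rho> y] by metis
  have q_pos: "0 < q" using \<rho> vol(4) by (simp add: q)
  have card_q: "real (card S) \<le> 1 / q"
    using card vol(4) \<rho> by (simp add: q field_simps)
  have U_ball: "measure ?U (cball (y s) (\<rho> / 4)) = q" if "s \<in> S" for s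
  proof -
    have "K \<inter> cball (y s) (\<rho> / 4) = cball (y s) (\<rho> / 4)"
      using y[of s] that S(2) by auto
    then show ?thesis
      using vol \<rho> by (simp add: q content_cball)
  qed
  have "q \<le> 1" if "s \<in> S" for s
    using U_ball[OF that] U.prob_le_1 by metis
  define miss where "miss s = {\<omega> \<in> space ?M. \<forall>i\<in>{1..n}. \<omega> i \<notin> cball (y s) (\<rho> / 4)}" for s
  have miss_sets: "miss s \<in> sets ?M" for s
    unfolding miss_def mem_cball by measurable
  have miss_prob: "measure ?M (miss s) \<le> exp (- (q * real n))" if "s \<in> S" for s
  proof -
    have "measure ?M (miss s) = (1 - q) ^ n"
      unfolding miss_def M_eq using U.iid_miss_all[of "{1..n}" "cball (y s) (\<rho> / 4)"] U_ball[OF that]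
      by simp
    also have "\<dots> \<le> exp (- q) ^ n"
      using exp_ge_add_one_self[of "- q"] \<open>s \<in> S \<Longrightarrow> q \<le> 1\<close> that by (intro power_mono) auto
    also have "\<dots> = exp (- (q * real n))"
      by (simp add: exp_of_nat_mult[symmetric] mult.commute)
    finally show ?thesis .
  qed
  let ?C = "{\<omega> \<in> space ?M. k_connected k (geometric_realization (vietoris_rips (\<omega> ` {1..n}) r))}"
  have C_sets: "?C \<in> sets ?M" by (rule sets_k_connected_event) simp
  have good: "\<omega> \<in> ?C" if "\<omega> \<in> space ?M" "\<omega> \<notin> (\<Union>s\<in>S. miss s)" "\<forall>i\<in>{1..n}. \<omega> i \<in> K" for \<omega>
  proof -
    have "\<exists>x\<in>\<omega> ` {1..n}. dist p x \<le> 3 * \<rho>" if "p \<in> K" for p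
    proof -
      obtain s where s: "s \<in> S" "dist p s \<le> 2 * \<rho>" using net[OF \<open>p \<in> K\<close>] by blast
      then obtain i where i: "i \<in> {1..n}" "\<omega> i \<in> cball (y s) (\<rho> / 4)"
        using \<open>\<omega> \<in> space ?M\<close> \<open>\<omega> \<notin> (\<Union>s\<in>S. miss s)\<close> by (auto simp: miss_def)
      have "cball (y s) (\<rho> / 4) \<subseteq> cball s \<rho>"
        using y[of s] s(1) S(2) by blast
      then have "dist s (\<omega> i) \<le> \<rho>" using i(2) by (meson mem_cball subsetD)
      then have "dist p (\<omega> i) \<le> 3 * \<rho>" using s(2) dist_triangle[of p "\<omega> i" s] by simp
      then show ?thesis using i by blast
    qed
    then have "contractible_space (geometric_realization (vietoris_rips (\<omega> ` {1..n}) r))"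
      using that(3) K(2) \<rho> r by (intro contractible_vietoris_rips_of_dense[of _ K "3 * \<rho>"]) auto
    then show ?thesis using that(1) k_connected_contractible by blast
  qed
  have "AE \<omega> in ?M. \<forall>i\<in>{1..n}. \<omega> i \<in> K"
  proof (subst AE_finite_all)
    show "\<forall>i\<in>{1..n}. AE \<omega> in ?M. \<omega> i \<in> K"
      unfolding M_eq using vol(1)
      by (intro ballI AE_PiM_component U.prob_space_axioms AE_uniform_measureI) auto
  qed simp
  then have "AE \<omega> in ?M. \<omega> \<notin> (\<Union>s\<in>S. miss s) \<longrightarrow> \<omega> \<in> ?C"
    using good by (auto elim!: eventually_mono simp: space_iid_uniform)
  then have "AE \<omega> in ?M. \<omega> \<in> space ?M - (\<Union>s\<in>S. miss s) \<longrightarrow> \<omega> \<in> ?C"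
    by (rule eventually_mono) blast
  then have "M.prob (space ?M - (\<Union>s\<in>S. miss s)) \<le> M.prob ?C"
    using C_sets by (rule M.finite_measure_mono_AE)
  moreover have "M.prob (space ?M - (\<Union>s\<in>S. miss s)) = 1 - M.prob (\<Union>s\<in>S. miss s)"
    using miss_sets S(1) by (intro M.prob_compl) auto
  moreover have "M.prob (\<Union>s\<in>S. miss s) \<le> (\<Sum>s\<in>S. M.prob (miss s))"
    using S(1) miss_sets by (rule measure_UNION_le)
  moreover have "\<dots> \<le> real (card S) * exp (- (q * real n))"
    using sum_mono[of S "\<lambda>s. M.prob (miss s)" "\<lambda>_. exp (- (q * real n))"] miss_prob by simp
  moreover have "\<dots> \<le> 1 / q * exp (- (q * real n))"
    using card_q by (intro mult_right_mono) auto
  ultimately show ?thesis by simp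
qed

text \<open>The constant is \<open>1536 * a = 384 * (4 * a)\<close>, where \<open>a\<^sup>d = 2 * v / \<omega>\<^sub>d\<close> and \<open>\<omega>\<^sub>d\<close> is the
  volume of the unit ball.  At the scale \<open>\<rho> n = 4 * a * (ln n / n) powr (1 / d)\<close> this makes the
  hitting probability exactly \<open>q = 2 * ln n / n\<close>, so the failure probability
  \<open>exp (- (q * n)) / q = 1 / (2 * n * ln n)\<close> vanishes.  Only the threshold from which \<open>n\<close> has to be
  large depends on the shape of \<open>K\<close>, through the radius below which balls of radius \<open>\<rho> / 4\<close> fit.\<close>

theorem theorem6p5:
  fixes k :: nat and v :: real
  shows "\<exists>c>0. \<forall>(K :: (real ^ 'd) set) (r :: nat \<Rightarrow> real).
    convex_body K \<longrightarrow> smoothly_bounded K \<longrightarrow> measure lborel K = v \<longrightarrow>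
    (\<forall>n\<ge>1. r n \<ge> c * (ln (real n) / real n) powr (1 / real CARD('d))) \<longrightarrow>
    (\<lambda>n. \<P>(\<omega> in iid_uniform K.
        k_connected k (geometric_realization (vietoris_rips (\<omega> ` {1..n}) (r n)))))
      \<longlonglongrightarrow> 1"
proof (cases "v > 0")
  \<comment> \<open>No convex body has volume \<open>v\<close>, so any constant will do.\<close>
  case False
  then show ?thesis
    using convex_body_volume(4)[where 'a = "real ^ 'd"] by (intro exI[of _ 1]) auto
next
  case v: True
  let ?d = "CARD('d)"
  define a where "a = (2 * v / unit_ball_vol (real ?d)) powr (1 / real ?d)"
  have ubv: "0 < unit_ball_vol (real ?d)" by simp
  have a_pos: "0 < a"
    using v less_imp_neq[OF ubv] by (simp add: a_def)
  have "a ^ ?d = a powr real ?d"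
    using powr_realpow[OF a_pos] by simp
  also have "\<dots> = 2 * v / unit_ball_vol (real ?d)"
    using v ubv by (simp add: a_def powr_powr)
  finally have a: "0 < a" "a ^ ?d = 2 * v / unit_ball_vol (real ?d)"
    using a_pos by simp_all
  show ?thesis
  proof (intro exI[of _ "1536 * a"] conjI allI impI)
    fix K :: "(real ^ 'd) set" and r :: "nat \<Rightarrow> real"
    assume body: "convex_body K" and smooth: "smoothly_bounded K" and vol: "measure lborel K = v"
      and r: "\<forall>n\<ge>1. r n \<ge> 1536 * a * (ln (real n) / real n) powr (1 / real ?d)"
    let ?P = "\<lambda>n. \<P>(\<omega> in iid_uniform K.
        k_connected k (geometric_realization (vietoris_rips (\<omega> ` {1..n}) (r n))))"
    define \<rho> where "\<rho> n = 4 * a * (ln (real n) / real n) powr (1 / real ?d)" for n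
    obtain \<rho>0 where \<rho>0: "0 < \<rho>0"
      and balls: "\<And>x \<rho>. x \<in> K \<Longrightarrow> 0 < \<rho> \<Longrightarrow> \<rho> \<le> \<rho>0 \<Longrightarrow> \<exists>y. cball y (\<rho> / 4) \<subseteq> K \<inter> cball x \<rho>"
      using smooth_body_uniform_balls[OF body smooth] by blast
    have "\<rho> \<longlonglongrightarrow> 4 * a * 0"
      unfolding \<rho>_def
    proof (intro tendsto_mult_left tendsto_zero_powrI)
      show "(\<lambda>n. ln (real n) / real n) \<longlonglongrightarrow> 0" by (rule lim_ln_over_n)
      show "\<forall>\<^sub>F n in sequentially. 0 \<le> ln (real n) / real n"
        using eventually_ge_at_top[of 1] by eventually_elim simp
    qed auto
    then have small: "\<forall>\<^sub>F n in sequentially. \<rho> n < \<rho>0"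
      using \<rho>0 by (intro order_tendstoD) auto
    have lower: "\<forall>\<^sub>F n in sequentially. 1 - 1 / real n \<le> ?P n"
      using small eventually_ge_at_top[of 2]
    proof eventually_elim
      case (elim n)
      define q where "q = measure lborel (cball (0 :: real ^ 'd) (\<rho> n / 4)) / measure lborel K"
      have ln: "0 < ln (real n)" "1 / 2 \<le> ln (real n)"
      proof -
        have "ln 2 \<le> ln (real n)" using elim by (subst ln_le_cancel_iff) auto
        then show "0 < ln (real n)" "1 / 2 \<le> ln (real n)"
          using ln2_ge_two_thirds by auto
      qed
      have x: "0 < ln (real n) / real n" using ln elim by simp
      have powr_pos: "0 < (ln (real n) / real n) powr (1 / real ?d)"
        unfolding powr_gt_zero using x by (metis less_irrefl)
      then have \<rho>n: "0 < \<rho> n"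
        unfolding \<rho>_def using a(1) by (intro mult_pos_pos) auto
      have "(\<rho> n / 4) ^ ?d = a ^ ?d * (ln (real n) / real n)"
      proof -
        have "((ln (real n) / real n) powr (1 / real ?d)) ^ ?d = ln (real n) / real n"
          unfolding powr_realpow[OF powr_pos, symmetric] powr_powr using ln(1) by simp
        then show ?thesis by (simp add: \<rho>_def power_mult_distrib)
      qed
      then have q: "q = 2 * ln (real n) / real n"
        using \<rho>n v less_imp_neq[OF ubv] by (simp add: q_def content_cball vol a(2))
      have "1 - exp (- (q * real n)) / q \<le> ?P n"
      proof (rule prob_k_connected_ge[OF body \<rho>n _ _ q_def])
        show "384 * \<rho> n \<le> r n" using r[rule_format, of n] elim by (simp add: \<rho>_def mult.assoc)
        show "\<exists>y. cball y (\<rho> n / 4) \<subseteq> K \<inter> cball x (\<rho> n)" if "x \<in> K" for x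
          using balls[OF that \<rho>n] elim by simp
      qed
      moreover have "exp (- (q * real n)) / q \<le> 1 / real n"
      proof -
        have "exp (- (q * real n)) = exp (- ln (real n)) * exp (- ln (real n))"
          using elim by (simp add: q flip: exp_add)
        also have "\<dots> = 1 / real n ^ 2"
          using elim by (simp add: exp_minus power2_eq_square inverse_eq_divide)
        finally show ?thesis
          using elim ln by (simp add: q power2_eq_square divide_simps)
      qed
      ultimately show ?case by simp
    qed
    have upper: "?P n \<le> 1" for n
    proof -
      interpret prob_space "iid_uniform K"
        unfolding iid_uniform_def using convex_body_volume[OF body]
        by (intro prob_space_PiM prob_space_uniform_measure)
      show ?thesis by (rule prob_le_1)
    qed
    have "(\<lambda>n. 1 - 1 / real n) \<longlonglongrightarrow> 1 - 0"
      by (intro tendsto_intros lim_1_over_n)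
    then have lim: "(\<lambda>n. 1 - 1 / real n) \<longlonglongrightarrow> 1" by simp
    show "?P \<longlonglongrightarrow> 1"
      by (rule tendsto_sandwich[OF lower _ lim tendsto_const]) (rule always_eventually, rule allI, rule upper)
  qed (use a in simp)
qed

end
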